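(* Let $\kappa>\aleph_0$ be a regular cardinal, and let $$\mathrm{CUB}=\{\eta\in{}^{\kappa}2:\text{ there is a closed unbounded set } C\subseteq\kappa \text{ such that } \eta(i)=1 \text{ for all } i\in C\}.$$ Then $\mathrm{CUB}$ does not have the property of Baire (as a subset of ${}^{\kappa}2$).
   Context: ${}^{\kappa}2$ is the set of functions $\kappa\to\{0,1\}$. For $\nu\in{}^{<\kappa}2=\bigcup_{i<\kappa}{}^{i}2$ put $[\nu]=\{\eta\in{}^{\kappa}2:\nu\subseteq\eta\}$. The space ${}^{\kappa}2$ has the topology with the sets $[\nu]$, $\nu\in{}^{<\kappa}2$, as basic open sets: $A\subseteq{}^{\kappa}2$ is open if for every $\eta\in A$ there is $i<\kappa$ with $[\eta\restriction i]\subseteq A$. A set $A\subseteq{}^{\kappa}2$ is nowhere dense if for every $\nu\in{}^{<\kappa}2$ there is $\eta\in{}^{<\kappa}2$ extending $\nu$ with $A\cap[\eta]=\emptyset$. $A$ is meager if $A=\bigcup_{\xi<\kappa}R_\xi$ where each $R_\xi\subseteq{}^{\kappa}2$ is nowhere dense (a union of $\kappa$ many nowhere dense sets). $A$ has the property of Baire if there is an open set $O\subseteq{}^{\kappa}2$ such that $(O\setminus A)\cup(A\setminus O)$ is meager. *)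

theory Defs
  imports "HOL-Analysis.Abstract_Topology"
begin

unbundle cardinal_syntax

text \<open>
  A cardinal \<open>\<kappa>\<close> is given by a cardinal order \<open>r\<close> (\<open>Card_order r\<close>). The ordinals below \<open>\<kappa>\<close> are the
  elements of \<open>Field r\<close>, and such an ordinal \<open>i\<close>, viewed as the set of its predecessors,
  is \<open>underS r i\<close>.

  Functions from an ordinal to \<open>{0,1}\<close> are partial functions with values in \<open>bool\<close> (1 is
  \<open>True\<close>) and with the ordinal as domain. So \<open>\<nu> \<subseteq> \<eta>\<close> is \<open>\<nu> \<subseteq>\<^sub>m \<eta>\<close>, and the restriction of \<open>\<eta>\<close>
  to \<open>i\<close> is \<open>\<eta> |` underS r i\<close>.
\<close>

definition full_seqs :: "'a rel \<Rightarrow> ('a \<rightharpoonup> bool) set" where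
  "full_seqs r = {\<eta>. dom \<eta> = Field r}"

definition initial_seqs :: "'a rel \<Rightarrow> ('a \<rightharpoonup> bool) set" where
  "initial_seqs r = (\<Union>i\<in>Field r. {\<nu>. dom \<nu> = underS r i})"

definition cone :: "'a rel \<Rightarrow> ('a \<rightharpoonup> bool) \<Rightarrow> ('a \<rightharpoonup> bool) set" where
  "cone r \<nu> = {\<eta> \<in> full_seqs r. \<nu> \<subseteq>\<^sub>m \<eta>}"

definition bounded_open :: "'a rel \<Rightarrow> ('a \<rightharpoonup> bool) set \<Rightarrow> bool" where
  "bounded_open r A \<longleftrightarrow> A \<subseteq> full_seqs r \<and>
     (\<forall>\<eta>\<in>A. \<exists>i\<in>Field r. cone r (\<eta> |` underS r i) \<subseteq> A)"

text \<open>
  The predicate \<open>bounded_open r\<close> is a topology because \<open>r\<close> is a linear order;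
  see \<open>openin_bounded_topology\<close>.
\<close>

definition bounded_topology :: "'a rel \<Rightarrow> ('a \<rightharpoonup> bool) topology" where
  "bounded_topology r = topology (bounded_open r)"

definition nowhere_dense :: "'a rel \<Rightarrow> ('a \<rightharpoonup> bool) set \<Rightarrow> bool" where
  "nowhere_dense r A \<longleftrightarrow> A \<subseteq> full_seqs r \<and>
     (\<forall>\<nu>\<in>initial_seqs r. \<exists>\<eta>\<in>initial_seqs r. \<nu> \<subseteq>\<^sub>m \<eta> \<and> A \<inter> cone r \<eta> = {})"

definition meager :: "'a rel \<Rightarrow> ('a \<rightharpoonup> bool) set \<Rightarrow> bool" where
  "meager r A \<longleftrightarrow> (\<exists>R. (\<forall>\<xi>\<in>Field r. nowhere_dense r (R \<xi>)) \<and> A = (\<Union>\<xi>\<in>Field r. R \<xi>))"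

definition baire_property :: "'a rel \<Rightarrow> ('a \<rightharpoonup> bool) set \<Rightarrow> bool" where
  "baire_property r A \<longleftrightarrow>
     (\<exists>U. openin (bounded_topology r) U \<and> meager r ((U - A) \<union> (A - U)))"

text \<open>
  \<open>C\<close> is closed in \<open>\<kappa>\<close> if it contains every \<open>\<delta> < \<kappa>\<close> such that \<open>C \<inter> \<delta>\<close> is unbounded in the limit
  ordinal \<open>\<delta>\<close>. As the bound is strict, the condition \<open>\<forall>a\<in>underS r \<delta>. \<dots>\<close> fails for successors
  and holds vacuously for \<open>\<delta> = 0\<close>, so only \<open>0\<close> must be excluded explicitly. The library's
  \<open>cofinal C r\<close> is unboundedness of \<open>C\<close> in \<open>\<kappa>\<close>.
\<close>

definition club :: "'a rel \<Rightarrow> 'a set \<Rightarrow> bool" where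
  "club r C \<longleftrightarrow> C \<subseteq> Field r \<and> cofinal C r \<and>
     (\<forall>\<delta>\<in>Field r. underS r \<delta> \<noteq> {} \<and>
        (\<forall>a\<in>underS r \<delta>. \<exists>c\<in>C \<inter> underS r \<delta>. a \<in> underS r c) \<longrightarrow> \<delta> \<in> C)"

definition CUB :: "'a rel \<Rightarrow> ('a \<rightharpoonup> bool) set" where
  "CUB r = {\<eta> \<in> full_seqs r. \<exists>C. club r C \<and> (\<forall>i\<in>C. \<eta> i = Some True)}"

lemma istopology_bounded_open:
  assumes "Well_order r"
  shows "istopology (bounded_open r)"
proof -
  have mono: "cone r (\<eta> |` underS r j) \<subseteq> cone r (\<eta> |` underS r i)" if "(i, j) \<in> r" for \<eta> i j
  proof -
    have "trans r" "antisym r"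
      using assms by (auto simp: order_on_defs)
    then have "underS r i \<subseteq> underS r j"
      using that underS_incr by metis
    then have "\<eta> |` underS r i \<subseteq>\<^sub>m \<eta> |` underS r j"
      by (auto simp: map_le_def restrict_map_def)
    then show ?thesis
      by (auto simp: cone_def intro: map_le_trans)
  qed
  have "bounded_open r (S \<inter> T)" if S: "bounded_open r S" and T: "bounded_open r T" for S T
    unfolding bounded_open_def
  proof (intro conjI ballI)
    show "S \<inter> T \<subseteq> full_seqs r"
      using S by (auto simp: bounded_open_def)
    fix \<eta> assume "\<eta> \<in> S \<inter> T"
    then obtain i j where ij: "i \<in> Field r" "j \<in> Field r"
      "cone r (\<eta> |` underS r i) \<subseteq> S" "cone r (\<eta> |` underS r j) \<subseteq> T"
      using S T unfolding bounded_open_def by blast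
    then have "(i, j) \<in> r \<or> (j, i) \<in> r"
      using assms wo_rel.TOTALS[of r] by (simp add: wo_rel_def)
    then show "\<exists>k\<in>Field r. cone r (\<eta> |` underS r k) \<subseteq> S \<inter> T"
      using ij mono by blast
  qed
  moreover have "bounded_open r (\<Union>K)" if "\<forall>S\<in>K. bounded_open r S" for K
    using that unfolding bounded_open_def by (meson Sup_least UnionE Union_upper subset_trans)
  ultimately show ?thesis
    by (simp add: istopology_def)
qed

lemma openin_bounded_topology:
  "Well_order r \<Longrightarrow> openin (bounded_topology r) = bounded_open r"
  by (simp add: bounded_topology_def istopology_bounded_open)

end

theory Submission
  imports Defs
begin

text \<open>
  Given nowhere dense sets \<open>R \<xi>\<close> (\<open>\<xi> < \<kappa>\<close>), an initial sequence \<open>\<nu>\<close> and a bit \<open>b\<close>, build an increasing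
  sequence \<open>N \<xi>\<close> of initial sequences above \<open>\<nu>\<close>: take the union of all earlier ones, whose length
  \<open>\<delta> \<xi>\<close> is below \<open>\<kappa>\<close> by regularity, append the value \<open>b\<close> at position \<open>\<delta> \<xi>\<close>, and extend further so
  that the cone misses \<open>R \<xi>\<close>. The positions \<open>\<delta> \<xi>\<close> form a club, so the limit avoids every \<open>R \<xi>\<close> and
  equals \<open>b\<close> on a club. Suppose \<open>CUB\<close> differs from an open \<open>U\<close> by the union of the \<open>R \<xi>\<close>. If \<open>U\<close> is
  empty, \<open>b = 1\<close> gives an element of \<open>CUB\<close> outside this union. Otherwise start inside \<open>U\<close> with \<open>b = 0\<close>:
  since two clubs meet, the limit is an element of \<open>U - CUB\<close> outside the union.
\<close>

section \<open>The well-order of \<kappa>: bounds for small sets and the meeting of clubs\<close>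

locale regular_uncountable =
  fixes r :: "'a rel"
  assumes card: "Card_order r" and regular: "regularCard r" and uncountable: "natLeq <o r"
begin

lemma wo: "wo_rel r"
  using card by (simp add: card_order_on_def wo_rel_def)

lemma infinite_Field: "infinite (Field r)"
proof
  assume "finite (Field r)"
  then have "|Field r| <o natLeq"
    by (simp add: finite_iff_ordLess_natLeq)
  then have "r <o natLeq"
    using card_of_Field_ordIso[OF card] ordIso_ordLess_trans ordIso_symmetric by blast
  then show False
    using uncountable ordLess_transitive ordLess_irreflexive by blast
qed

lemma underS_less_trans: "a \<in> underS r b \<Longrightarrow> b \<in> underS r c \<Longrightarrow> a \<in> underS r c"
  using wo_rel.TRANS[OF wo] wo_rel.ANTISYM[OF wo]
  unfolding underS_def trans_def antisym_def by blast

lemma underS_linear: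
  "a \<in> Field r \<Longrightarrow> b \<in> Field r \<Longrightarrow> a \<in> underS r b \<or> a = b \<or> b \<in> underS r a"
  using wo_rel.TOTALS[OF wo] unfolding underS_def by blast

lemma underS_subset_iff:
  assumes "a \<in> Field r" "b \<in> Field r"
  shows "underS r a \<subseteq> underS r b \<longleftrightarrow> b \<notin> underS r a"
  using underS_linear[OF assms] underS_less_trans underS_notIn by (metis subset_iff)

lemma underS_less_induct [case_names less]:
  assumes "\<And>x. (\<And>y. y \<in> underS r x \<Longrightarrow> P y) \<Longrightarrow> P x"
  shows "P a"
proof (rule wo_rel.well_order_induct[OF wo])
  show "P x" if "\<forall>y. y \<noteq> x \<and> (y, x) \<in> r \<longrightarrow> P y" for x
    using that assms by (auto simp: underS_def)
qed

lemma underS_least: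
  assumes "P a" "a \<in> Field r"
  shows "\<exists>b\<in>Field r. P b \<and> (\<forall>c\<in>underS r b. \<not> P c)"
  using assms
proof (induction a rule: underS_less_induct)
  case (less x)
  show ?case
  proof (cases "\<exists>y\<in>underS r x. P y")
    case True
    then obtain y where "y \<in> underS r x" "P y"
      by blast
    then show ?thesis
      using less.IH underS_Field by metis
  next
    case False
    then show ?thesis
      using less.prems by blast
  qed
qed

lemma no_maximum: "a \<in> Field r \<Longrightarrow> \<exists>b\<in>Field r. a \<in> underS r b"
  using infinite_Card_order_limit[OF card infinite_Field] unfolding underS_def by blast

text \<open>By regularity a set of size below \<kappa> is not cofinal. This yields only a weak bound
  \<open>a\<close>; since \<kappa> is a limit, some \<open>b\<close> above \<open>a\<close> is a
  strict one.\<close>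

lemma small_bounded:
  assumes "A \<subseteq> Field r" "|A| <o r"
  shows "\<exists>b\<in>Field r. A \<subseteq> underS r b"
proof -
  have "\<not> cofinal A r"
    using regular assms ordLess_irreflexive ordIso_ordLess_trans ordIso_symmetric
    unfolding regularCard_def by blast
  then obtain a where a: "a \<in> Field r" "\<And>x. x \<in> A \<Longrightarrow> x = a \<or> x \<in> underS r a"
    using underS_linear assms(1) unfolding cofinal_def underS_def by blast
  obtain b where "b \<in> Field r" "a \<in> underS r b"
    using no_maximum a(1) by blast
  then show ?thesis
    using a(2) underS_less_trans by blast
qed

text \<open>An initial segment is either all of \<kappa> or an ordinal below it, and
  \<open>c\<close> rules out the former. This turns unions of domains into lengths.\<close>

lemma ofilter_proper:
  assumes "wo_rel.ofilter r A" "c \<in> Field r" "c \<notin> A"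
  shows "\<exists>a\<in>Field r. A = underS r a"
  using assms wo_rel.ofilter_underS_Field[OF wo] by metis

text \<open>Interleave \<open>C\<close> and \<open>D\<close> in an \<open>\<omega>\<close>-sequence; its supremum \<open>d\<close> is below \<open>\<kappa>\<close> as \<open>\<kappa>\<close> has uncountable cofinality.\<close>
lemma clubs_meet:
  assumes C: "club r C" and D: "club r D"
  shows "C \<inter> D \<noteq> {}"
proof -
  have sub: "C \<subseteq> Field r" "D \<subseteq> Field r"
    using C D by (simp_all add: club_def)
  have beyond: "\<exists>c\<in>E. a \<in> underS r c" if "club r E" "a \<in> Field r" for E a
    using that unfolding club_def cofinal_def underS_def by blast
  define next_in where "next_in E a = (SOME c. c \<in> E \<and> a \<in> underS r c)" for E a
  have next_in: "next_in E a \<in> E \<and> a \<in> underS r (next_in E a)"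
    if "club r E" "a \<in> Field r" for E a
    using beyond[OF that] unfolding next_in_def by (metis (mono_tags, lifting) someI_ex)
  obtain a0 where a0: "a0 \<in> Field r"
    using infinite_Field by fastforce
  define f where "f = rec_nat a0 (\<lambda>_ a. next_in D (next_in C a))"
  have f_Suc: "f (Suc n) = next_in D (next_in C (f n))" for n
    by (simp add: f_def)
  have f_Field: "f n \<in> Field r" for n
  proof (induction n)
    case 0
    then show ?case by (simp add: f_def a0)
  next
    case (Suc n)
    have "next_in C (f n) \<in> Field r"
      using next_in[OF C Suc] sub(1) by blast
    then show ?case
      using next_in[OF D] sub(2) unfolding f_Suc by blast
  qed
  have between: "f n \<in> underS r (next_in C (f n))" "next_in C (f n) \<in> C"
    "next_in C (f n) \<in> underS r (f (Suc n))" "f (Suc n) \<in> D" for n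
    using next_in[OF C f_Field] next_in[OF D, of "next_in C (f n)"] sub(1)
    unfolding f_Suc by auto
  have "|range f| \<le>o natLeq"
    using card_of_image card_of_nat ordLeq_ordIso_trans by blast
  then have "|range f| <o r"
    using uncountable ordLeq_ordLess_trans by blast
  then obtain b where "b \<in> Field r" "range f \<subseteq> underS r b"
    using small_bounded[of "range f"] f_Field by blast
  \<comment> \<open>\<open>d\<close> is the supremum of the sequence: the least strict upper bound
    of its values.\<close>
  then obtain d where d: "range f \<subseteq> underS r d" "d \<in> Field r"
    and least: "\<And>c. c \<in> underS r d \<Longrightarrow> \<not> range f \<subseteq> underS r c"
    using underS_least[of "\<lambda>c. range f \<subseteq> underS r c" b] by meson
  \<comment> \<open>No \<open>a\<close> below \<open>d\<close> bounds the sequence, so some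
    \<open>f n\<close> is at least \<open>a\<close>, and the next point of \<open>C\<close> lies
    strictly above \<open>a\<close>.\<close>
  have "\<exists>n. a \<in> underS r (next_in C (f n))" if "a \<in> underS r d" for a
  proof -
    have "a \<in> Field r"
      using that underS_Field by fast
    moreover obtain n where "f n \<notin> underS r a"
      using least[OF \<open>a \<in> underS r d\<close>] by blast
    ultimately show ?thesis
      using underS_linear[of a "f n"] f_Field between(1) underS_less_trans by blast
  qed
  moreover have "next_in C (f n) \<in> underS r d" "f (Suc n) \<in> underS r d" for n
    using d between(3) underS_less_trans by blast+
  ultimately have limit: "\<forall>a\<in>underS r d. \<exists>c\<in>E \<inter> underS r d. a \<in> underS r c" if "E = C \<or> E = D" for E
    using that between by (meson IntI underS_less_trans)
  have "underS r d \<noteq> {}"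
    using d(1) by blast
  then have "d \<in> E" if "E = C \<or> E = D" "club r E" for E
    using that(2) limit[OF that(1)] d(2) by (simp add: club_def)
  then show ?thesis
    using C D by blast
qed

section \<open>The transfinite construction of initial sequences\<close>

text \<open>One stage of the construction, for successor and limit stages alike. Fewer than \<kappa>
  lengths have a bound below \<kappa>, so the union of the chain is again an initial sequence; after
  \<open>b\<close> is appended, nowhere density supplies the extension that misses
  \<open>A\<close>.\<close>

lemma extend_chain:
  assumes S: "S \<subseteq> initial_seqs r" and small: "|S| <o r"
    and chain: "\<And>m n. m \<in> S \<Longrightarrow> n \<in> S \<Longrightarrow> m \<subseteq>\<^sub>m n \<or> n \<subseteq>\<^sub>m m"
    and A: "nowhere_dense r A"
  shows "\<exists>\<delta>\<in>Field r. \<exists>m\<in>initial_seqs r. underS r \<delta> = (\<Union>n\<in>S. dom n) \<and> m \<delta> = Some b \<and>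
           (\<forall>n\<in>S. n \<subseteq>\<^sub>m m) \<and> A \<inter> cone r m = {}"
proof -
  obtain d where d: "d n \<in> Field r" "dom n = underS r (d n)" if "n \<in> S" for n
    using S unfolding initial_seqs_def by (simp add: subset_iff) metis
  have "|d ` S| <o r"
    using small card_of_image ordLeq_ordLess_trans by blast
  then obtain c where c: "c \<in> Field r" "d ` S \<subseteq> underS r c"
    using small_bounded[of "d ` S"] d by blast
  have ofilter: "wo_rel.ofilter r (\<Union>n\<in>S. dom n)"
    by (rule wo_rel.ofilter_UNION[OF wo]) (simp add: d(2) wo_rel.underS_ofilter[OF wo])
  have "c \<notin> (\<Union>n\<in>S. dom n)"
  proof
    assume "c \<in> (\<Union>n\<in>S. dom n)"
    then obtain n where "n \<in> S" "c \<in> underS r (d n)"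
      using d(2) by blast
    then show False
      using c(2) underS_less_trans underS_notIn by (metis image_subset_iff)
  qed
  then obtain \<delta> where \<delta>: "\<delta> \<in> Field r" "(\<Union>n\<in>S. dom n) = underS r \<delta>"
    using ofilter_proper[OF ofilter c(1)] by blast
  \<comment> \<open>The ordinal \<epsilon> found here is the successor of \<delta>, the length of
    the sequence once \<open>b\<close> is appended.\<close>
  obtain e where "e \<in> Field r" "\<delta> \<in> underS r e"
    using no_maximum \<delta>(1) by blast
  moreover from this have "e \<notin> under r \<delta>"
    using wo_rel.ANTISYM[OF wo] unfolding under_def underS_def antisym_def by blast
  ultimately obtain \<epsilon> where \<epsilon>: "\<epsilon> \<in> Field r" "under r \<delta> = underS r \<epsilon>"
    using ofilter_proper[OF wo_rel.under_ofilter[OF wo]] by blast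
  \<comment> \<open>This is the union of the chain. The default \<open>Some False\<close> is correct
    because every point below \<delta> lies in the domain of some member of \<open>S\<close>, and
    members agree where both are defined.\<close>
  define \<mu> where "\<mu> = (\<lambda>x. if \<exists>n\<in>S. n x = Some True then Some True
                          else if x \<in> underS r \<delta> then Some False else None)"
  have agree: "m x = n x" if "m \<in> S" "n \<in> S" "x \<in> dom m" "x \<in> dom n" for m n x
    using chain[OF that(1,2)] that(3,4) unfolding map_le_def by metis
  have below: "n \<subseteq>\<^sub>m \<mu>" if "n \<in> S" for n
    unfolding map_le_def
  proof
    fix x assume x: "x \<in> dom n"
    then have "x \<in> underS r \<delta>"
      using \<delta>(2) that by blast
    moreover have "n x = Some True" if "m \<in> S" "m x = Some True" for m
      using agree[OF that(1) \<open>n \<in> S\<close> _ x] that(2) by (simp add: domI)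
    moreover obtain v where "n x = Some v"
      using x by blast
    ultimately show "n x = \<mu> x"
      unfolding \<mu>_def using that by (cases v) auto
  qed
  have "x \<in> underS r \<delta>" if "n \<in> S" "n x = Some True" for n x
    using \<delta>(2) that by blast
  then have dom_\<mu>: "dom \<mu> = underS r \<delta>"
    unfolding \<mu>_def by (auto split: if_splits)
  then have "dom (\<mu>(\<delta> \<mapsto> b)) = underS r \<epsilon>"
    using \<epsilon>(2) Refl_under_underS[OF wo_rel.REFL[OF wo] \<delta>(1)] by simp
  then have "\<mu>(\<delta> \<mapsto> b) \<in> initial_seqs r"
    using \<epsilon>(1) unfolding initial_seqs_def by blast
  then obtain m where m: "m \<in> initial_seqs r" "\<mu>(\<delta> \<mapsto> b) \<subseteq>\<^sub>m m" "A \<inter> cone r m = {}"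
    using A unfolding nowhere_dense_def by blast
  have "\<delta> \<notin> dom \<mu>"
    using dom_\<mu> by (simp add: underS_notIn)
  then have "\<mu> \<subseteq>\<^sub>m m"
    using m(2) unfolding map_le_def by (metis domD domI fun_upd_other)
  then have "\<forall>n\<in>S. n \<subseteq>\<^sub>m m"
    using below map_le_trans by blast
  moreover have "m \<delta> = Some b"
    using m(2) unfolding map_le_def by (metis dom_fun_upd fun_upd_same insertI1 option.distinct(1))
  ultimately show ?thesis
    using \<delta> m by metis
qed

text \<open>The outcome of \<open>extend_chain\<close> at stage \<xi>, made a predicate so that a
  recursion can choose \<open>m\<close> by it.\<close>

definition descends :: "('a \<Rightarrow> ('a \<rightharpoonup> bool) set) \<Rightarrow> bool \<Rightarrow> ('a \<rightharpoonup> bool) set \<Rightarrow> 'a \<Rightarrow> 'a \<Rightarrow> ('a \<rightharpoonup> bool) \<Rightarrow> bool"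
  where "descends R b S \<xi> \<delta> m \<longleftrightarrow> \<delta> \<in> Field r \<and> m \<in> initial_seqs r \<and>
     underS r \<delta> = (\<Union>n\<in>S. dom n) \<and> m \<delta> = Some b \<and> (\<forall>n\<in>S. n \<subseteq>\<^sub>m m) \<and> R \<xi> \<inter> cone r m = {}"

lemma exists_descending_sequence:
  assumes \<nu>: "\<nu> \<in> initial_seqs r" and R: "\<And>\<xi>. \<xi> \<in> Field r \<Longrightarrow> nowhere_dense r (R \<xi>)"
  shows "\<exists>\<delta> N. \<forall>\<xi>\<in>Field r. descends R b (insert \<nu> (N ` underS r \<xi>)) \<xi> (\<delta> \<xi>) (N \<xi>)"
proof -
  \<comment> \<open>The recursion chooses only the sequences; the positions \<delta> are picked
    afterwards. \<open>H\<close> sees \<open>N\<close> only through its image of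
    \<open>underS r \<xi>\<close>, hence it is admissible.\<close>
  define H where "H = (\<lambda>N \<xi>. SOME m. \<exists>\<delta>. descends R b (insert \<nu> (N ` underS r \<xi>)) \<xi> \<delta> m)"
  define N where "N = wo_rel.worec r H"
  have "wo_rel.adm_wo r H"
    unfolding wo_rel.adm_wo_def[OF wo]
  proof (intro allI impI)
    fix f g :: "'a \<Rightarrow> 'a \<rightharpoonup> bool" and x
    assume "\<forall>y\<in>underS r x. f y = g y"
    then have "f ` underS r x = g ` underS r x"
      by simp
    then show "H f x = H g x"
      by (simp add: H_def)
  qed
  then have "N = H N"
    unfolding N_def by (rule wo_rel.worec_fixpoint[OF wo])
  then have N: "N \<xi> = (SOME m. \<exists>\<delta>. descends R b (insert \<nu> (N ` underS r \<xi>)) \<xi> \<delta> m)" for \<xi>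
    unfolding H_def by metis
  \<comment> \<open>Induction is needed since the choice at \<xi> can succeed only if the earlier
    values are initial sequences and form a chain.\<close>
  have "\<xi> \<in> Field r \<longrightarrow> (\<exists>\<delta>. descends R b (insert \<nu> (N ` underS r \<xi>)) \<xi> \<delta> (N \<xi>))" for \<xi>
  proof (induction \<xi> rule: underS_less_induct)
    case (less \<xi>)
    show ?case
    proof
      assume \<xi>: "\<xi> \<in> Field r"
      let ?S = "insert \<nu> (N ` underS r \<xi>)"
      have IH: "\<exists>\<delta>. descends R b (insert \<nu> (N ` underS r \<zeta>)) \<zeta> \<delta> (N \<zeta>)" if "\<zeta> \<in> underS r \<xi>" for \<zeta>
        using less.IH[OF that] that underS_Field by fast
      then have N_initial: "N \<zeta> \<in> initial_seqs r" and \<nu>_le: "\<nu> \<subseteq>\<^sub>m N \<zeta>"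
        and N_mono: "\<And>\<zeta>'. \<zeta>' \<in> underS r \<zeta> \<Longrightarrow> N \<zeta>' \<subseteq>\<^sub>m N \<zeta>" if "\<zeta> \<in> underS r \<xi>" for \<zeta>
        using that unfolding descends_def by blast+
      have "N \<zeta> \<subseteq>\<^sub>m N \<zeta>' \<or> N \<zeta>' \<subseteq>\<^sub>m N \<zeta>" if "\<zeta> \<in> underS r \<xi>" "\<zeta>' \<in> underS r \<xi>" for \<zeta> \<zeta>'
        using underS_linear[of \<zeta> \<zeta>'] that N_mono underS_Field map_le_refl by (metis subsetD)
      then have chain: "m \<subseteq>\<^sub>m n \<or> n \<subseteq>\<^sub>m m" if "m \<in> ?S" "n \<in> ?S" for m n
        using that \<nu>_le map_le_refl by (auto simp del: map_le_refl)
      have "|?S| <o r"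
      proof -
        have "|N ` underS r \<xi>| <o r"
          using card_of_image card_of_underS[OF card \<xi>] ordLeq_ordLess_trans by blast
        moreover have "|{\<nu>}| <o r"
          using uncountable finite_iff_ordLess_natLeq[of "{\<nu>}"] ordLess_transitive by blast
        ultimately have "|{\<nu>} \<union> N ` underS r \<xi>| <o r"
          using card_of_Un_ordLess_infinite_Field[OF infinite_Field card] by blast
        then show ?thesis
          by simp
      qed
      moreover have "?S \<subseteq> initial_seqs r"
        using \<nu> N_initial by blast
      ultimately have "\<exists>m \<delta>. descends R b ?S \<xi> \<delta> m"
        using extend_chain[of ?S "R \<xi>" b] chain R[OF \<xi>] unfolding descends_def by blast
      then show "\<exists>\<delta>. descends R b ?S \<xi> \<delta> (N \<xi>)"
        unfolding N[of \<xi>] by (rule someI_ex)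
    qed
  qed
  then show ?thesis
    by metis
qed

section \<open>The limit sequence and its club of positions\<close>

text \<open>If \<delta> moved \<xi> down, monotonicity would make it move the smaller ordinal
  \<open>\<delta> \<xi>\<close> down as well, against the induction hypothesis.\<close>

lemma increasing_ge:
  assumes \<delta>: "\<And>\<xi>. \<xi> \<in> Field r \<Longrightarrow> \<delta> \<xi> \<in> Field r"
    and mono: "\<And>\<xi> \<zeta>. \<xi> \<in> Field r \<Longrightarrow> \<zeta> \<in> underS r \<xi> \<Longrightarrow> \<delta> \<zeta> \<in> underS r (\<delta> \<xi>)"
  shows "\<xi> \<in> Field r \<Longrightarrow> \<delta> \<xi> \<notin> underS r \<xi>"
proof (induction \<xi> rule: underS_less_induct)
  case (less \<xi>)
  show ?case
  proof
    assume "\<delta> \<xi> \<in> underS r \<xi>"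
    then show False
      using less.IH[of "\<delta> \<xi>"] mono[OF less.prems, of "\<delta> \<xi>"] \<delta>[OF less.prems] by blast
  qed
qed

text \<open>A Baire category argument that also controls values on a club. The map \<delta> is
  strictly increasing, and each \<open>\<delta> \<xi>\<close> is the supremum of the earlier
  lengths, which makes its range closed.\<close>

lemma generic_with_club:
  assumes \<nu>: "\<nu> \<in> initial_seqs r" and R: "\<And>\<xi>. \<xi> \<in> Field r \<Longrightarrow> nowhere_dense r (R \<xi>)"
  shows "\<exists>\<eta>\<in>cone r \<nu>. (\<forall>\<xi>\<in>Field r. \<eta> \<notin> R \<xi>) \<and> (\<exists>C. club r C \<and> (\<forall>i\<in>C. \<eta> i = Some b))"
proof -
  obtain \<delta> N where N: "\<And>\<xi>. \<xi> \<in> Field r \<Longrightarrow> descends R b (insert \<nu> (N ` underS r \<xi>)) \<xi> (\<delta> \<xi>) (N \<xi>)"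
    using exists_descending_sequence[OF \<nu>, of R b] R by blast
  have \<delta>_Field: "\<delta> \<xi> \<in> Field r" and N_initial: "N \<xi> \<in> initial_seqs r"
    and \<delta>_sup: "underS r (\<delta> \<xi>) = dom \<nu> \<union> (\<Union>\<zeta>\<in>underS r \<xi>. dom (N \<zeta>))"
    and N_\<delta>: "N \<xi> (\<delta> \<xi>) = Some b" and \<nu>_le: "\<nu> \<subseteq>\<^sub>m N \<xi>"
    and N_avoids: "R \<xi> \<inter> cone r (N \<xi>) = {}"
    if "\<xi> \<in> Field r" for \<xi>
    using N[OF that] unfolding descends_def by auto
  have N_mono: "N \<zeta> \<subseteq>\<^sub>m N \<xi>" if "\<xi> \<in> Field r" "\<zeta> \<in> underS r \<xi>" for \<zeta> \<xi>
    using N[OF that(1)] that(2) unfolding descends_def by auto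
  \<comment> \<open>The position \<open>\<delta> \<zeta>\<close> belongs to the domain of
    \<open>N \<zeta>\<close>, which lies below \<open>\<delta> \<xi>\<close>.\<close>
  have \<delta>_mono: "\<delta> \<zeta> \<in> underS r (\<delta> \<xi>)" if "\<xi> \<in> Field r" "\<zeta> \<in> underS r \<xi>" for \<zeta> \<xi>
    using \<delta>_sup[OF that(1)] N_\<delta>[of \<zeta>] that(2) underS_Field by fast
  have \<delta>_ge: "\<delta> \<xi> \<notin> underS r \<xi>" if "\<xi> \<in> Field r" for \<xi>
    using increasing_ge[of \<delta> \<xi>] \<delta>_Field \<delta>_mono that by blast
  have \<delta>_beyond: "\<exists>\<xi>\<in>Field r. a \<in> underS r (\<delta> \<xi>)" if "a \<in> Field r" for a
  proof -
    obtain \<xi> where \<xi>: "\<xi> \<in> Field r" "a \<in> underS r \<xi>"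
      using no_maximum[OF \<open>a \<in> Field r\<close>] by blast
    then show ?thesis
      using underS_linear[of "\<delta> a" a] \<delta>_ge[OF that] \<delta>_Field[OF that] \<delta>_mono[OF \<xi>] that
        underS_less_trans by metis
  qed
  have dom_N_subset: "dom (N \<zeta>) \<subseteq> underS r (\<delta> \<xi>)" if "\<xi> \<in> Field r" "\<zeta> \<in> underS r \<xi>" for \<zeta> \<xi>
    using \<delta>_sup[OF that(1)] that(2) by blast
  have "club r (\<delta> ` Field r)"
    unfolding club_def
  proof (intro conjI ballI impI)
    show "\<delta> ` Field r \<subseteq> Field r"
      using \<delta>_Field by blast
    show "cofinal (\<delta> ` Field r) r"
      using \<delta>_beyond unfolding cofinal_def underS_def by blast
    fix d assume d: "d \<in> Field r"
    assume lim: "underS r d \<noteq> {} \<and> (\<forall>a\<in>underS r d. \<exists>c\<in>\<delta> ` Field r \<inter> underS r d. a \<in> underS r c)"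
    \<comment> \<open>Take the least \<xi> with \<open>\<delta> \<xi>\<close> at least
      \<open>d\<close>; one exists because \<open>\<delta> d\<close> is at least \<open>d\<close>.
      All earlier lengths will be at most \<open>d\<close>, so \<open>\<delta> \<xi>\<close> equals
      \<open>d\<close>.\<close>
    obtain \<xi> where \<xi>: "\<delta> \<xi> \<notin> underS r d" "\<xi> \<in> Field r"
      and least: "\<And>\<zeta>. \<zeta> \<in> underS r \<xi> \<Longrightarrow> \<delta> \<zeta> \<in> underS r d"
      using underS_least[of "\<lambda>\<xi>. \<delta> \<xi> \<notin> underS r d", OF \<delta>_ge[OF d] d] by blast
    have "dom (N \<zeta>) \<subseteq> underS r d" if \<zeta>: "\<zeta> \<in> underS r \<xi>" for \<zeta>
    proof -
      \<comment> \<open>The limit hypothesis puts another position between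
        \<open>\<delta> \<zeta>\<close> and \<open>d\<close>. Its index exceeds \<zeta>, so it
        bounds the domain of \<open>N \<zeta>\<close>.\<close>
      obtain \<zeta>' where \<zeta>': "\<zeta>' \<in> Field r" "\<delta> \<zeta>' \<in> underS r d" "\<delta> \<zeta> \<in> underS r (\<delta> \<zeta>')"
        using lim least[OF \<zeta>] by blast
      have \<zeta>_Field: "\<zeta> \<in> Field r"
        using \<zeta> underS_Field by fast
      have "\<delta> \<zeta>' \<notin> underS r (\<delta> \<zeta>)"
        using \<zeta>'(3) underS_less_trans underS_notIn by metis
      then have "\<zeta> \<in> underS r \<zeta>'"
        using underS_linear[OF \<zeta>_Field \<zeta>'(1)] \<delta>_mono[OF \<zeta>_Field] \<zeta>'(3) underS_notIn by metis
      then show ?thesis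
        using dom_N_subset[OF \<zeta>'(1)] \<zeta>'(2) underS_less_trans by blast
    qed
    moreover have "dom \<nu> \<subseteq> underS r d"
    proof -
      obtain \<zeta>' where "\<zeta>' \<in> Field r" "\<delta> \<zeta>' \<in> underS r d"
        using lim by blast
      then show ?thesis
        using \<delta>_sup[of \<zeta>'] underS_less_trans by blast
    qed
    ultimately have "underS r (\<delta> \<xi>) \<subseteq> underS r d"
      using \<delta>_sup[OF \<xi>(2)] by blast
    then have "\<delta> \<xi> = d"
      using underS_subset_iff[OF \<delta>_Field[OF \<xi>(2)] d] underS_linear[OF d \<delta>_Field[OF \<xi>(2)]] \<xi>(1) by blast
    then show "d \<in> \<delta> ` Field r"
      using \<xi>(2) by blast
  qed
  moreover
  \<comment> \<open>The union of all \<open>N \<xi>\<close>. Any stage defined at \<open>x\<close>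
    gives the same value, so the choice is harmless.\<close>
  define \<eta> where "\<eta> x = (if x \<in> Field r then N (SOME \<xi>. \<xi> \<in> Field r \<and> x \<in> dom (N \<xi>)) x else None)" for x
  have covered: "\<exists>\<xi>. \<xi> \<in> Field r \<and> x \<in> dom (N \<xi>)" if x: "x \<in> Field r" for x
  proof -
    obtain \<xi> where "\<xi> \<in> Field r" "x \<in> underS r (\<delta> \<xi>)"
      using \<delta>_beyond[OF x] by blast
    moreover from this have "x \<in> dom \<nu> \<or> (\<exists>\<zeta>\<in>underS r \<xi>. x \<in> dom (N \<zeta>))"
      using \<delta>_sup by blast
    ultimately show ?thesis
      using \<nu>_le underS_Field by (metis map_le_implies_dom_le subsetD)
  qed
  have dom_Field: "dom (N \<xi>) \<subseteq> Field r" if "\<xi> \<in> Field r" for \<xi>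
    using N_initial[OF that] underS_Field unfolding initial_seqs_def by fastforce
  have agree: "N \<xi> x = N \<zeta> x" if "\<xi> \<in> Field r" "\<zeta> \<in> Field r" "x \<in> dom (N \<xi>)" "x \<in> dom (N \<zeta>)" for \<xi> \<zeta> x
    using underS_linear[OF that(1,2)] N_mono that unfolding map_le_def by metis
  have N_le: "N \<xi> \<subseteq>\<^sub>m \<eta>" if "\<xi> \<in> Field r" for \<xi>
    unfolding map_le_def
  proof
    fix x assume x: "x \<in> dom (N \<xi>)"
    then have "x \<in> Field r"
      using dom_Field that by blast
    moreover from this have "(SOME \<zeta>. \<zeta> \<in> Field r \<and> x \<in> dom (N \<zeta>)) \<in> Field r \<and>
        x \<in> dom (N (SOME \<zeta>. \<zeta> \<in> Field r \<and> x \<in> dom (N \<zeta>)))"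
      using someI_ex[OF covered] by blast
    ultimately show "N \<xi> x = \<eta> x"
      using agree[OF that _ x] unfolding \<eta>_def by simp
  qed
  have "dom \<eta> = Field r"
  proof
    show "dom \<eta> \<subseteq> Field r"
      unfolding \<eta>_def by (auto split: if_splits)
    show "Field r \<subseteq> dom \<eta>"
      using covered N_le map_le_implies_dom_le by blast
  qed
  then have full: "\<eta> \<in> full_seqs r"
    unfolding full_seqs_def by simp
  obtain a where "a \<in> Field r"
    using infinite_Field by fastforce
  then have "\<eta> \<in> cone r \<nu>"
    using full \<nu>_le N_le map_le_trans unfolding cone_def by blast
  moreover have "\<eta> \<notin> R \<xi>" if "\<xi> \<in> Field r" for \<xi>
    using N_avoids[OF that] full N_le[OF that] unfolding cone_def by blast
  moreover have "\<forall>i\<in>\<delta> ` Field r. \<eta> i = Some b"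
    using N_le N_\<delta> unfolding map_le_def by (metis domI imageE)
  ultimately show ?thesis
    by blast
qed

section \<open>The two cases for the open set\<close>

lemma CUB_not_baire: "\<not> baire_property r (CUB r)"
proof
  assume "baire_property r (CUB r)"
  then obtain U R where U: "bounded_open r U" and R: "\<And>\<xi>. \<xi> \<in> Field r \<Longrightarrow> nowhere_dense r (R \<xi>)"
    and diff: "(U - CUB r) \<union> (CUB r - U) = (\<Union>\<xi>\<in>Field r. R \<xi>)"
    unfolding baire_property_def meager_def openin_bounded_topology[OF wo[unfolded wo_rel_def]]
    by blast
  have initial: "\<eta> |` underS r i \<in> initial_seqs r" if "\<eta> \<in> full_seqs r" "i \<in> Field r" for \<eta> i
    using that underS_Field unfolding initial_seqs_def full_seqs_def by fastforce
  show False
  proof (cases "U = {}")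
    case True
    obtain i where i: "i \<in> Field r"
      using infinite_Field by fastforce
    \<comment> \<open>The constant sequence serves only to produce some initial sequence to start
      from.\<close>
    have "(\<lambda>x. if x \<in> Field r then Some True else None) \<in> full_seqs r"
      unfolding full_seqs_def by (auto split: if_splits)
    then obtain \<nu> where "\<nu> \<in> initial_seqs r"
      using initial i by blast
    then obtain \<eta> where "\<eta> \<in> CUB r" "\<forall>\<xi>\<in>Field r. \<eta> \<notin> R \<xi>"
      using generic_with_club[of \<nu> R True] R unfolding CUB_def cone_def by blast
    then show False
      using diff True by blast
  next
    case False
    then obtain \<theta> i where "\<theta> \<in> full_seqs r" "i \<in> Field r" and sub: "cone r (\<theta> |` underS r i) \<subseteq> U"
      using U unfolding bounded_open_def by blast
    then obtain \<eta> C where \<eta>: "\<eta> \<in> U" "\<forall>\<xi>\<in>Field r. \<eta> \<notin> R \<xi>"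
      and C: "club r C" "\<forall>i\<in>C. \<eta> i = Some False"
      using generic_with_club[OF initial, of \<theta> i R False] R by blast
    \<comment> \<open>A club witnessing membership would meet \<open>C\<close>, and \<eta> would
      take both values at a common point.\<close>
    have "\<eta> \<notin> CUB r"
      using clubs_meet[OF C(1)] C(2) unfolding CUB_def by fastforce
    then show False
      using diff \<eta> by blast
  qed
qed

end

theorem theorem4p2:
  fixes r :: "'a rel"
  assumes "Card_order r" and "regularCard r" and "natLeq <o r"
  shows "\<not> baire_property r (CUB r)"
  by (rule regular_uncountable.CUB_not_baire) (simp add: regular_uncountable_def assms)

end
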